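(* Fix an integer $r\ge 4$, and reals $a>0$, $b\ge 1$, and $0<\delta<1/(r-1)$. Let $(G_N)$ be a sequence of graphs with $t_N=\chi_{\mathrm f}(G_N)\to\infty$ as $N\to\infty$. Suppose each $G_N$ has a $(<r)$-cycle clique cover $\mathcal K_N$ such that, for all sufficiently large $N$, $$b(\mathcal K_N)\le b,\qquad I(\mathcal K_N)\le N^a,\qquad |K|\le N\quad(K\in\mathcal K_N).$$ Assume additionally that the subgraph of $G_N$ induced by the vertices not lying in any clique of $\mathcal K_N$ has fractional chromatic number $o(t_N)$. If $$\frac{N^{-1+\delta}t_N}{\log t_N}\to\infty,$$ then $h_r^{\mathrm f}(G_N)\to\infty$. More quantitatively, for $p_N=N^{-1+\delta}$, $$h_r^{\mathrm f}(G_N)\ge c\,\frac{p_Nt_N}{\log t_N}$$ for all large $N$, where $c>0$ depends only on $r,a,b,\delta$.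
   Context: All graphs are finite and simple; subgraphs need not be induced unless stated. $\chi_{\mathrm f}$ is the fractional chromatic number, with $\chi_{\mathrm f}(\emptyset)=0$; $\log$ is natural. The girth of a forest is $\infty$. $h_r^{\mathrm f}(G)=\max\{\chi_{\mathrm f}(H):H\subseteq G,\ \operatorname{girth}(H)\ge r\}$. A family $\mathcal K$ of cliques (complete subgraphs) of $G$ is a $(<r)$-cycle clique cover if every cycle of $G$ of length less than $r$ is contained in some member of $\mathcal K$. Its vertex-incidence number is $I(\mathcal K)=\sum_{K\in\mathcal K}|V(K)|$ and its local overlap is $b(\mathcal K)=\max_{v\in V(G)}|\{K\in\mathcal K: v\in V(K)\}|$. $|K|$ denotes the number of vertices of the clique $K$. *)

theory Defs
  imports Complex_Main "HOL-Library.Extended_Nat" "HOL-Library.Landau_Symbols"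
begin

datatype 'v graph = Graph (verts: "'v set") (edges: "'v set set")

definition simple_graph :: "'v graph \<Rightarrow> bool" where
  "simple_graph G \<longleftrightarrow> finite (verts G) \<and> (\<forall>e\<in>edges G. e \<subseteq> verts G \<and> card e = 2)"

definition subgraph :: "'v graph \<Rightarrow> 'v graph \<Rightarrow> bool" where
  "subgraph H G \<longleftrightarrow> simple_graph H \<and> verts H \<subseteq> verts G \<and> edges H \<subseteq> edges G"

definition induced_subgraph :: "'v graph \<Rightarrow> 'v set \<Rightarrow> 'v graph" where
  "induced_subgraph G W = Graph (verts G \<inter> W) {e \<in> edges G. e \<subseteq> W}"

definition independent_set :: "'v graph \<Rightarrow> 'v set \<Rightarrow> bool" where
  "independent_set G S \<longleftrightarrow> S \<subseteq> verts G \<and> (\<forall>e\<in>edges G. \<not> e \<subseteq> S)"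

definition fractional_colouring :: "'v graph \<Rightarrow> ('v set \<Rightarrow> real) \<Rightarrow> bool" where
  "fractional_colouring G w \<longleftrightarrow>
     (\<forall>S. independent_set G S \<longrightarrow> 0 \<le> w S) \<and>
     (\<forall>v\<in>verts G. 1 \<le> (\<Sum>S | independent_set G S \<and> v \<in> S. w S))"

(* The optimal value of the covering linear program over independent sets.  For a finite graph
   the infimum is over a nonempty set bounded below by 0; the graph without vertices has value 0. *)
definition fractional_chromatic_number :: "'v graph \<Rightarrow> real" where
  "fractional_chromatic_number G =
     Inf {(\<Sum>S | independent_set G S. w S) | w. fractional_colouring G w}"

(* Cycles are regarded as graphs; the length of the cycle C is card (verts C). *)
definition cycle_graph :: "'v graph \<Rightarrow> bool" where
  "cycle_graph C \<longleftrightarrow>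
     (\<exists>vs. 3 \<le> length vs \<and> distinct vs \<and> verts C = set vs \<and>
           edges C = {{vs ! i, vs ! (Suc i mod length vs)} | i. i < length vs})"

(* Forests have girth \<infinity>, because Inf {} = \<infinity> in enat. *)
definition girth :: "'v graph \<Rightarrow> enat" where
  "girth G = Inf {enat (card (verts C)) | C. cycle_graph C \<and> subgraph C G}"

definition high_girth_frac_chi :: "nat \<Rightarrow> 'v graph \<Rightarrow> real" where
  "high_girth_frac_chi r G =
     Max {fractional_chromatic_number H | H. subgraph H G \<and> enat r \<le> girth H}"

definition clique_in :: "'v graph \<Rightarrow> 'v graph \<Rightarrow> bool" where
  "clique_in G K \<longleftrightarrow> subgraph K G \<and> edges K = {e. e \<subseteq> verts K \<and> card e = 2}"

definition short_cycle_clique_cover :: "nat \<Rightarrow> 'v graph \<Rightarrow> 'v graph set \<Rightarrow> bool" where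
  "short_cycle_clique_cover r G \<K> \<longleftrightarrow>
     (\<forall>K\<in>\<K>. clique_in G K) \<and>
     (\<forall>C. cycle_graph C \<and> subgraph C G \<and> card (verts C) < r \<longrightarrow> (\<exists>K\<in>\<K>. subgraph C K))"

definition vertex_incidence_number :: "'v graph set \<Rightarrow> nat" where
  "vertex_incidence_number \<K> = (\<Sum>K\<in>\<K>. card (verts K))"

(* The inserted 0 only matters when G has no vertices. *)
definition local_overlap :: "'v graph \<Rightarrow> 'v graph set \<Rightarrow> nat" where
  "local_overlap G \<K> = Max (insert 0 ((\<lambda>v. card {K \<in> \<K>. v \<in> verts K}) ` verts G))"

definition uncovered_subgraph :: "'v graph \<Rightarrow> 'v graph set \<Rightarrow> 'v graph" where
  "uncovered_subgraph G \<K> = induced_subgraph G (verts G - (\<Union>K\<in>\<K>. verts K))"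

end

theory Submission
  imports Defs
begin

text \<open>
  Keep every edge of \<open>G\<close> independently with probability \<open>p\<close> and delete a maximal edge-disjoint family
  of the surviving short cycles, leaving \<open>H\<close> of girth at least \<open>r\<close>. An edge lies in at most \<open>b\<close>
  cliques of at most \<open>N\<close> vertices, so the expected number of short cycles meeting a set of \<open>m\<close> edges
  is \<open>O(m p N\<^bsup>\<delta>(r - 2) - 1\<^esup>) = o(m p)\<close>, and all \<open>m\<close> edges are lost with probability at most
  \<open>exp (- p m / 2)\<close>. A set of \<open>k\<close> covered vertices inducing minimum degree at least \<open>d\<close> spans at
  least \<open>k d / 2\<close> edges, so for \<open>d\<close> of order \<open>(a + 1) log N / p\<close> a union bound shows that some \<open>H\<close> has
  an edge inside every such set. Independent sets of \<open>H\<close> are then \<open>(d - 1)\<close>-degenerate in \<open>G\<close>,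
  hence \<open>d\<close>-colourable, so that the covered part of \<open>G\<close> has fractional chromatic number at most
  \<open>d\<close> times that of \<open>H\<close>. Finally \<open>p t \<ge> log t\<close> forces \<open>log N = O(log t)\<close>.
\<close>

section \<open>Finite sums and weights of random subsets\<close>

lemma sum_UN_le:
  fixes f :: "'a \<Rightarrow> 'b::ordered_comm_monoid_add"
  assumes "finite I" "\<And>i. i \<in> I \<Longrightarrow> finite (A i)" "\<And>x. 0 \<le> f x"
  shows "sum f (\<Union>i\<in>I. A i) \<le> (\<Sum>i\<in>I. sum f (A i))"
  using assms(1,2)
proof (induction I rule: finite_induct)
  case (insert i I)
  have "sum f (A i \<union> (\<Union>j\<in>I. A j)) + 0
      \<le> sum f (A i \<union> (\<Union>j\<in>I. A j)) + sum f (A i \<inter> (\<Union>j\<in>I. A j))"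
    by (intro add_left_mono sum_nonneg assms)
  also have "\<dots> = sum f (A i) + sum f (\<Union>j\<in>I. A j)"
    using insert by (intro sum.union_inter) auto
  also have "\<dots> \<le> sum f (A i) + (\<Sum>j\<in>I. sum f (A j))"
    using insert by (intro add_left_mono) auto
  finally show ?case using insert by simp
qed simp

lemma sum_Pow_power_card:
  fixes x y :: "'b::comm_semiring_1"
  assumes "finite A"
  shows "(\<Sum>X\<in>Pow A. x ^ card X * y ^ card (A - X)) = (x + y) ^ card A"
proof -
  have "(\<Prod>a\<in>A. x + y) = (\<Sum>X\<in>Pow A. (\<Prod>a\<in>X. x) * (\<Prod>a\<in>A - X. y))"
    by (rule prod_add[OF assms])
  then show ?thesis by simp
qed

lemma sum_Pow_prod_eq_prod_one_plus:
  fixes f :: "'a \<Rightarrow> 'b::comm_semiring_1"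
  assumes "finite A"
  shows "(\<Sum>X\<in>Pow A. \<Prod>a\<in>X. f a) = (\<Prod>a\<in>A. 1 + f a)"
proof -
  have "(\<Prod>a\<in>A. f a + 1) = (\<Sum>X\<in>Pow A. (\<Prod>a\<in>X. f a) * (\<Prod>a\<in>A - X. 1))"
    by (rule prod_add[OF assms])
  then show ?thesis by (simp add: add.commute)
qed

text \<open>Probability is expressed by finite sums: for \<open>p\<close> in [0, 1],
  \<open>p ^ card A * (1 - p) ^ card (E - A)\<close> is the chance that the \<open>p\<close>-random
  subset of \<open>E\<close> equals \<open>A\<close>. The elements outside \<open>U\<close> and
  \<open>V\<close> are free and contribute a total factor
  \<open>(p + (1 - p)) ^ card ?R = 1\<close>.\<close>

lemma sum_bernoulli_between:
  fixes p :: real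
  assumes "finite E" "U \<subseteq> E" "V \<subseteq> E" "U \<inter> V = {}"
  shows "(\<Sum>A | A \<subseteq> E \<and> U \<subseteq> A \<and> A \<inter> V = {}. p ^ card A * (1 - p) ^ card (E - A))
           = p ^ card U * (1 - p) ^ card V"
proof -
  let ?R = "E - U - V"
  have fin: "finite U" "finite V" "finite ?R"
    using assms finite_subset by auto
  have "(\<Sum>A | A \<subseteq> E \<and> U \<subseteq> A \<and> A \<inter> V = {}. p ^ card A * (1 - p) ^ card (E - A))
      = (\<Sum>X\<in>Pow ?R. p ^ card U * (1 - p) ^ card V * (p ^ card X * (1 - p) ^ card (?R - X)))"
  proof (rule sum.reindex_bij_witness[of _ "\<lambda>X. X \<union> U" "\<lambda>A. A - U"])
    fix A assume A: "A \<in> {A. A \<subseteq> E \<and> U \<subseteq> A \<and> A \<inter> V = {}}"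
    then have finA: "finite (A - U)"
      using assms(1) finite_subset by blast
    have "A = U \<union> (A - U)" "E - A = V \<union> (?R - (A - U))"
      using A assms by auto
    moreover have "card (U \<union> (A - U)) = card U + card (A - U)"
      by (rule card_Un_disjoint) (use fin finA in auto)
    moreover have "card (V \<union> (?R - (A - U))) = card V + card (?R - (A - U))"
      by (rule card_Un_disjoint) (use fin in auto)
    ultimately have "card A = card U + card (A - U)" "card (E - A) = card V + card (?R - (A - U))"
      by simp_all
    then show "p ^ card U * (1 - p) ^ card V * (p ^ card (A - U) * (1 - p) ^ card (?R - (A - U)))
        = p ^ card A * (1 - p) ^ card (E - A)"
      by (simp add: power_add)
  qed (use assms in auto)
  also have "\<dots> = p ^ card U * (1 - p) ^ card V * (p + (1 - p)) ^ card ?R"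
    by (simp add: sum_distrib_left[symmetric] sum_Pow_power_card[OF fin(3)] del: Diff_iff)
  finally show ?thesis by simp
qed

section \<open>The deletion method for a random subset\<close>

text \<open>A nonempty member missing \<open>\<Union>\<F>\<close> could be added to a maximal
  \<open>\<F>\<close>. Hence deleting \<open>\<Union>\<F>\<close> destroys every nonempty member of
  \<open>\<A>\<close> at once.\<close>

lemma obtain_maximal_disjoint_subfamily:
  assumes "finite \<A>"
  obtains \<F> where "\<F> \<subseteq> \<A>" "pairwise disjnt \<F>"
    "\<And>C. C \<in> \<A> \<Longrightarrow> C \<noteq> {} \<Longrightarrow> C \<inter> \<Union>\<F> \<noteq> {}"
proof -
  let ?P = "{\<F>. \<F> \<subseteq> \<A> \<and> pairwise disjnt \<F>}"
  have "finite ?P" "{} \<in> ?P" using assms by auto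
  then obtain \<F> where F: "\<F> \<in> ?P" and max: "\<And>\<G>. \<G> \<in> ?P \<Longrightarrow> \<F> \<subseteq> \<G> \<Longrightarrow> \<F> = \<G>"
    using finite_has_maximal2 by (metis (no_types, lifting))
  have "C \<inter> \<Union>\<F> \<noteq> {}" if C: "C \<in> \<A>" "C \<noteq> {}" for C
  proof
    assume *: "C \<inter> \<Union>\<F> = {}"
    then have "insert C \<F> \<in> ?P"
      using F C by (auto simp: pairwise_insert disjnt_def)
    then have "C \<in> \<F>" using max by blast
    with * C show False by blast
  qed
  with F that show ?thesis by blast
qed

text \<open>
  The event that \<open>\<F>\<close> explains why \<open>A\<close> retains nothing of \<open>Q\<close> outside \<open>\<Union>\<F>\<close> has
  probability \<open>p\<^bsup>|\<Union>\<F>|\<^esup> (1 - p)\<^bsup>|Q - \<Union>\<F>|\<^esup>\<close>; summing over all \<open>\<F>\<close> gives a product.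
\<close>

lemma weight_explained_le:
  fixes p :: real
  assumes "finite E" "0 \<le> p" "p \<le> 1 / 2" "Q \<subseteq> E"
    and \<C>: "\<And>C. C \<in> \<C> \<Longrightarrow> C \<subseteq> E \<and> card C \<le> r"
    and mu: "2 ^ r * (\<Sum>C\<in>\<C>. p ^ card C) \<le> p * card Q / 2"
  shows "(\<Sum>A | A \<subseteq> E \<and> (\<exists>\<F>\<subseteq>\<C>. pairwise disjnt \<F> \<and> \<Union>\<F> \<subseteq> A \<and> A \<inter> (Q - \<Union>\<F>) = {}).
            p ^ card A * (1 - p) ^ card (E - A)) \<le> exp (- (p * card Q / 2))"
proof -
  define D where "D = {\<F>. \<F> \<subseteq> \<C> \<and> pairwise disjnt \<F>}"
  define ev where "ev \<F> = {A. A \<subseteq> E \<and> \<Union>\<F> \<subseteq> A \<and> A \<inter> (Q - \<Union>\<F>) = {}}" for \<F>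
  let ?w = "\<lambda>A. p ^ card A * (1 - p) ^ card (E - A)"
  have w0: "0 \<le> ?w A" for A using assms by simp
  have finC: "finite \<C>"
    using \<C> assms(1) by (meson Pow_iff finite_Pow_iff finite_subset subsetI)
  have finD: "finite D" unfolding D_def using finC by auto
  have finev: "finite (ev \<F>)" for \<F> unfolding ev_def using assms(1) by auto
  have bound: "sum ?w (ev \<F>) \<le> (1 - p) ^ card Q * (\<Prod>C\<in>\<F>. 2 ^ r * p ^ card C)" if "\<F> \<in> D" for \<F>
  proof -
    have F: "\<F> \<subseteq> \<C>" "pairwise disjnt \<F>" using that by (auto simp: D_def)
    have sub: "\<Union>\<F> \<subseteq> E" using F \<C> by blast
    have finU: "finite (\<Union>\<F>)" and finQ: "finite Q"
      using sub assms finite_subset by auto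
    have cU: "card (\<Union>\<F>) = (\<Sum>C\<in>\<F>. card C)"
      using F \<C> assms(1) by (intro card_Union_disjoint) (auto intro: finite_subset)
    have "sum ?w (ev \<F>) = p ^ card (\<Union>\<F>) * (1 - p) ^ card (Q - \<Union>\<F>)"
      unfolding ev_def by (rule sum_bernoulli_between) (use assms sub in auto)
    \<comment> \<open>Removing \<open>\<Union>\<F>\<close> from \<open>Q\<close> loses at most
      \<open>card (\<Union>\<F>)\<close> factors \<open>1 - p\<close>. Each is at least 1/2, so a
      factor 2 per element of \<open>\<Union>\<F>\<close> pays for it.\<close>
    also have "\<dots> \<le> p ^ card (\<Union>\<F>) * ((1 - p) ^ card Q * 2 ^ card (\<Union>\<F>))"
    proof (rule mult_left_mono)
      have "card Q \<le> card (Q - \<Union>\<F>) + card (\<Union>\<F>)"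
        using finU finQ by (simp add: diff_card_le_card_Diff le_diff_conv[symmetric])
      then have "(1 - p) ^ (card (Q - \<Union>\<F>) + card (\<Union>\<F>)) \<le> (1 - p) ^ card Q"
        using assms by (intro power_decreasing) auto
      then have "(1 - p) ^ (card (Q - \<Union>\<F>) + card (\<Union>\<F>)) * 2 ^ card (\<Union>\<F>)
          \<le> (1 - p) ^ card Q * 2 ^ card (\<Union>\<F>)"
        by (intro mult_right_mono) auto
      moreover have "1 \<le> ((1 - p) * 2) ^ card (\<Union>\<F>)"
        using assms by (intro one_le_power) auto
      then have "(1 - p) ^ card (Q - \<Union>\<F>) * 1
          \<le> (1 - p) ^ card (Q - \<Union>\<F>) * ((1 - p) * 2) ^ card (\<Union>\<F>)"
        using assms by (intro mult_left_mono) auto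
      ultimately show "(1 - p) ^ card (Q - \<Union>\<F>) \<le> (1 - p) ^ card Q * 2 ^ card (\<Union>\<F>)"
        unfolding power_add power_mult_distrib by (simp only: mult.assoc mult_1_right)
    qed (use assms in auto)
    also have "\<dots> = (1 - p) ^ card Q * (\<Prod>C\<in>\<F>. 2 ^ card C * p ^ card C)"
      by (simp add: cU power_sum prod.distrib)
    also have "\<dots> \<le> (1 - p) ^ card Q * (\<Prod>C\<in>\<F>. 2 ^ r * p ^ card C)"
      using F \<C> assms by (intro mult_left_mono prod_mono) (auto intro!: mult_right_mono power_increasing)
    finally show ?thesis .
  qed
  have "(\<Sum>A | A \<subseteq> E \<and> (\<exists>\<F>\<subseteq>\<C>. pairwise disjnt \<F> \<and> \<Union>\<F> \<subseteq> A \<and> A \<inter> (Q - \<Union>\<F>) = {}). ?w A)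
      = sum ?w (\<Union>\<F>\<in>D. ev \<F>)"
    by (rule sum.cong) (auto simp: D_def ev_def)
  also have "\<dots> \<le> (\<Sum>\<F>\<in>D. sum ?w (ev \<F>))"
    using finD finev w0 by (intro sum_UN_le) auto
  also have "\<dots> \<le> (\<Sum>\<F>\<in>D. (1 - p) ^ card Q * (\<Prod>C\<in>\<F>. 2 ^ r * p ^ card C))"
    by (intro sum_mono bound)
  \<comment> \<open>Dropping disjointness only adds nonnegative terms, and the sum over all
    subfamilies factorises over the members of \<open>\<C>\<close>.\<close>
  also have "\<dots> \<le> (\<Sum>\<F>\<in>Pow \<C>. (1 - p) ^ card Q * (\<Prod>C\<in>\<F>. 2 ^ r * p ^ card C))"
    using finC assms by (intro sum_mono2) (auto simp: D_def intro!: mult_nonneg_nonneg prod_nonneg)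
  also have "\<dots> = (1 - p) ^ card Q * (\<Prod>C\<in>\<C>. 1 + 2 ^ r * p ^ card C)"
    by (simp add: sum_distrib_left[symmetric] sum_Pow_prod_eq_prod_one_plus[OF finC])
  also have "\<dots> \<le> exp (- p) ^ card Q * (\<Prod>C\<in>\<C>. exp (2 ^ r * p ^ card C))"
    using assms exp_ge_add_one_self[of "- p"]
    by (intro mult_mono power_mono prod_mono prod_nonneg) auto
  also have "\<dots> = exp (- (p * card Q) + 2 ^ r * (\<Sum>C\<in>\<C>. p ^ card C))"
    using exp_of_nat_mult[of "card Q" "- p"]
    by (simp add: exp_sum[OF finC] sum_distrib_left exp_diff exp_minus divide_inverse mult.commute)
  \<comment> \<open>By \<open>mu\<close>, the members of \<open>\<C>\<close> use up at most half of
    the exponent \<open>p * card Q\<close>.\<close>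
  also have "\<dots> \<le> exp (- (p * card Q / 2))" using mu by simp
  finally show ?thesis .
qed

text \<open>By the union bound some \<open>A\<close> lies outside every event \<open>bad i\<close>.
  Deleting a maximal disjoint family of members of \<open>\<C>\<close> inside \<open>A\<close>
  leaves no member, and losing all of \<open>Q i\<close> would put \<open>A\<close> into
  \<open>bad i\<close>. The events allow every disjoint family, so the family can be chosen after
  \<open>A\<close>.\<close>

lemma exists_hitting_set_avoiding:
  fixes p :: real
  assumes "finite E" "0 \<le> p" "p \<le> 1 / 2" "finite I"
    and \<C>: "\<And>C. C \<in> \<C> \<Longrightarrow> C \<subseteq> E \<and> C \<noteq> {} \<and> card C \<le> r"
    and Q: "\<And>i. i \<in> I \<Longrightarrow> Q i \<subseteq> E"
    and mu: "\<And>i. i \<in> I \<Longrightarrow> 2 ^ r * (\<Sum>C | C \<in> \<C> \<and> C \<inter> Q i \<noteq> {}. p ^ card C) \<le> p * card (Q i) / 2"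
    and total: "(\<Sum>i\<in>I. exp (- (p * card (Q i) / 2))) < 1"
  shows "\<exists>B\<subseteq>E. (\<forall>C\<in>\<C>. \<not> C \<subseteq> B) \<and> (\<forall>i\<in>I. B \<inter> Q i \<noteq> {})"
proof -
  define bad where "bad i = {A. A \<subseteq> E \<and> (\<exists>\<F>\<subseteq>{C. C \<in> \<C> \<and> C \<inter> Q i \<noteq> {}}.
      pairwise disjnt \<F> \<and> \<Union>\<F> \<subseteq> A \<and> A \<inter> (Q i - \<Union>\<F>) = {})}" for i
  let ?w = "\<lambda>A. p ^ card A * (1 - p) ^ card (E - A)"
  have w0: "0 \<le> ?w A" for A using assms by simp
  have "sum ?w (\<Union>i\<in>I. bad i) \<le> (\<Sum>i\<in>I. sum ?w (bad i))"
    using assms w0 by (intro sum_UN_le) (auto simp: bad_def)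
  also have "\<dots> \<le> (\<Sum>i\<in>I. exp (- (p * card (Q i) / 2)))"
    unfolding bad_def
    by (intro sum_mono weight_explained_le[where r = r]) (use assms in auto)
  \<comment> \<open>The weights of all subsets of \<open>E\<close> add up to 1.\<close>
  also have "\<dots> < sum ?w (Pow E)"
    using total sum_Pow_power_card[OF assms(1), of p "1 - p"] by simp
  finally have "\<not> Pow E \<subseteq> (\<Union>i\<in>I. bad i)"
    using sum_mono2[of "\<Union>i\<in>I. bad i" "Pow E" ?w] w0 assms by (force simp: bad_def)
  then obtain A where A: "A \<subseteq> E" "\<And>i. i \<in> I \<Longrightarrow> A \<notin> bad i" by blast
  have "finite \<C>"
    using \<C> assms(1) by (meson Pow_iff finite_Pow_iff finite_subset subsetI)
  then obtain \<F> where F: "\<F> \<subseteq> {C \<in> \<C>. C \<subseteq> A}" "pairwise disjnt \<F>"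
    and max: "\<And>C. C \<in> {C \<in> \<C>. C \<subseteq> A} \<Longrightarrow> C \<noteq> {} \<Longrightarrow> C \<inter> \<Union>\<F> \<noteq> {}"
    using obtain_maximal_disjoint_subfamily[of "{C \<in> \<C>. C \<subseteq> A}"] by auto
  have "\<not> C \<subseteq> A - \<Union>\<F>" if "C \<in> \<C>" for C
    using max[of C] \<C>[OF that] that by blast
  moreover have "(A - \<Union>\<F>) \<inter> Q i \<noteq> {}" if "i \<in> I" for i
  proof
    assume *: "(A - \<Union>\<F>) \<inter> Q i = {}"
    \<comment> \<open>Members of \<open>\<F>\<close> disjoint from \<open>Q i\<close> remove nothing
      from it, so those meeting \<open>Q i\<close> already witness \<open>bad i\<close>. This is why
      \<open>mu\<close> counts only members that meet \<open>Q i\<close>.\<close>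
    let ?G = "{C \<in> \<F>. C \<inter> Q i \<noteq> {}}"
    have "?G \<subseteq> {C. C \<in> \<C> \<and> C \<inter> Q i \<noteq> {}}" "\<Union>?G \<subseteq> A" "A \<inter> (Q i - \<Union>?G) = {}"
      using F(1) * by blast+
    moreover have "pairwise disjnt ?G" using F(2) by (rule pairwise_subset) auto
    ultimately have "A \<in> bad i" using A(1) unfolding bad_def by blast
    with A(2) that show False by blast
  qed
  ultimately show ?thesis using A(1) by (intro exI[of _ "A - \<Union>\<F>"]) auto
qed

section \<open>Finiteness facts and comparison of fractional chromatic numbers\<close>

lemma finite_edges: "simple_graph G \<Longrightarrow> finite (edges G)"
  by (rule finite_subset[of _ "Pow (verts G)"]) (auto simp: simple_graph_def)

lemma finite_independent_sets: "simple_graph G \<Longrightarrow> finite {S. independent_set G S \<and> P S}"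
  by (rule finite_subset[of _ "Pow (verts G)"]) (auto simp: simple_graph_def independent_set_def)

lemma finite_subgraphs:
  assumes "simple_graph G"
  shows "finite {H. subgraph H G}"
proof (rule finite_subset)
  show "{H. subgraph H G} \<subseteq> (\<lambda>(V, E). Graph V E) ` (Pow (verts G) \<times> Pow (edges G))"
  proof
    fix H assume "H \<in> {H. subgraph H G}"
    then show "H \<in> (\<lambda>(V, E). Graph V E) ` (Pow (verts G) \<times> Pow (edges G))"
      by (intro image_eqI[of _ _ "(verts H, edges H)"]) (auto simp: subgraph_def)
  qed
  show "finite ((\<lambda>(V, E). Graph V E) ` (Pow (verts G) \<times> Pow (edges G)))"
    using assms finite_edges by (auto simp: simple_graph_def)
qed

lemma simple_graph_induced: "simple_graph G \<Longrightarrow> simple_graph (induced_subgraph G W)"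
  by (auto simp: simple_graph_def induced_subgraph_def)

lemma independent_set_induced:
  "independent_set (induced_subgraph G W) S \<longleftrightarrow> S \<subseteq> W \<and> independent_set G S"
  unfolding induced_subgraph_def independent_set_def graph.sel by blast

lemma independent_set_empty: "simple_graph G \<Longrightarrow> independent_set G {}"
  by (fastforce simp: independent_set_def simple_graph_def)

lemma independent_set_mono: "independent_set G S \<Longrightarrow> T \<subseteq> S \<Longrightarrow> independent_set G T"
  unfolding independent_set_def by blast

text \<open>The sets \<open>T i\<close> may repeat: an independent set receives the total weight of
  its fibre under \<open>T\<close>. Upper bounds can thus use convenient index sets such as products
  and disjoint sums.\<close>

lemma fractional_chromatic_number_le:
  assumes G: "simple_graph G" and "finite I"
    and T: "\<And>i. i \<in> I \<Longrightarrow> independent_set G (T i)"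
    and u: "\<And>i. i \<in> I \<Longrightarrow> 0 \<le> u i"
    and cover: "\<And>v. v \<in> verts G \<Longrightarrow> 1 \<le> (\<Sum>i | i \<in> I \<and> v \<in> T i. u i)"
  shows "fractional_chromatic_number G \<le> sum u I"
proof -
  define w where "w S = (\<Sum>i | i \<in> I \<and> T i = S. u i)" for S
  have total: "(\<Sum>S | independent_set G S. w S) = sum u I"
    unfolding w_def using assms finite_independent_sets[OF G, of "\<lambda>_. True"]
    by (intro sum.group) auto
  have "1 \<le> (\<Sum>S | independent_set G S \<and> v \<in> S. w S)" if "v \<in> verts G" for v
  proof -
    have "(\<Sum>i | i \<in> I \<and> v \<in> T i. u i)
        = (\<Sum>S | independent_set G S \<and> v \<in> S. sum u {i \<in> {i. i \<in> I \<and> v \<in> T i}. T i = S})"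
      using assms finite_independent_sets[OF G] by (intro sum.group[symmetric]) auto
    also have "\<dots> = (\<Sum>S | independent_set G S \<and> v \<in> S. w S)"
      unfolding w_def by (intro sum.cong refl) auto
    finally show ?thesis using cover[OF that] by simp
  qed
  then have "fractional_colouring G w"
    unfolding fractional_colouring_def w_def by (auto intro: sum_nonneg u)
  moreover have "bdd_below {(\<Sum>S | independent_set G S. w S) | w. fractional_colouring G w}"
    by (rule bdd_belowI[of _ 0]) (auto simp: fractional_colouring_def intro!: sum_nonneg)
  ultimately show ?thesis
    unfolding fractional_chromatic_number_def total[symmetric] by (intro cInf_lower) auto
qed

text \<open>A bound valid for every colouring passes to the infimum once some colouring exists. The
  constant weight 1 is one, since singletons are independent.\<close>

lemma le_fractional_chromatic_number:
  assumes G: "simple_graph G"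
    and le: "\<And>w. fractional_colouring G w \<Longrightarrow> c \<le> (\<Sum>S | independent_set G S. w S)"
  shows "c \<le> fractional_chromatic_number G"
proof -
  have "1 \<le> (\<Sum>S | independent_set G S \<and> v \<in> S. 1 :: real)" if "v \<in> verts G" for v
  proof -
    have "independent_set G {v}"
      using G that by (auto simp: independent_set_def simple_graph_def subset_singleton_iff)
    then have "{S. independent_set G S \<and> v \<in> S} \<noteq> {}" by blast
    then show ?thesis
      using finite_independent_sets[OF G, of "\<lambda>S. v \<in> S"] by (simp add: Suc_le_eq card_gt_0_iff)
  qed
  then have "fractional_colouring G (\<lambda>_. 1)" by (simp add: fractional_colouring_def)
  then show ?thesis
    unfolding fractional_chromatic_number_def using le by (intro cInf_greatest) auto
qed

text \<open>Split each independent set \<open>S\<close> of \<open>H\<close> into its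
  \<open>d\<close> colour classes and give each class the weight of \<open>S\<close>. A vertex of
  \<open>S\<close> lies in exactly one class, so covering is preserved, while the total weight is
  multiplied by \<open>d\<close>.\<close>

lemma fractional_chromatic_number_le_mult:
  assumes G: "simple_graph G" and H: "simple_graph H" "verts H = verts G" and "0 < d"
    and f: "\<And>S. independent_set H S \<Longrightarrow>
      \<exists>f. \<forall>v\<in>S. f v < d \<and> independent_set G {u \<in> S. f u = f v}"
  shows "fractional_chromatic_number G \<le> real d * fractional_chromatic_number H"
proof -
  obtain f where f: "\<And>S v. independent_set H S \<Longrightarrow> v \<in> S \<Longrightarrow> f S v < d"
      "\<And>S v. independent_set H S \<Longrightarrow> v \<in> S \<Longrightarrow> independent_set G {u \<in> S. f S u = f S v}"
    using f by metis
  have "fractional_chromatic_number G / real d \<le> fractional_chromatic_number H"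
  proof (rule le_fractional_chromatic_number[OF H(1)])
    fix w assume w: "fractional_colouring H w"
    let ?J = "{S. independent_set H S}"
    have finJ: "finite ?J" using finite_independent_sets[OF H(1), of "\<lambda>_. True"] by simp
    have "fractional_chromatic_number G \<le> sum (\<lambda>(S, i). w S) (?J \<times> {..<d})"
    proof (rule fractional_chromatic_number_le[OF G, where T = "\<lambda>(S, i). {u \<in> S. f S u = i}"])
      fix x assume "x \<in> ?J \<times> {..<d}"
      then obtain S i where x: "x = (S, i)" "independent_set H S" by auto
      show "independent_set G (case x of (S, i) \<Rightarrow> {u \<in> S. f S u = i})"
      proof (cases "\<exists>v\<in>S. f S v = i")
        case True
        then show ?thesis using x f(2) by auto
      next
        case False
        then have "{u \<in> S. f S u = i} = {}" by auto
        then show ?thesis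
          using x independent_set_empty[OF G] by (simp only: case_prod_conv)
      qed
      show "0 \<le> (case x of (S, i) \<Rightarrow> w S)"
        using x w by (auto simp: fractional_colouring_def)
    next
      fix v assume v: "v \<in> verts G"
      have "1 \<le> (\<Sum>S | independent_set H S \<and> v \<in> S. w S)"
        using w v H by (auto simp: fractional_colouring_def)
      also have "\<dots> = (\<Sum>x | x \<in> ?J \<times> {..<d} \<and> v \<in> (case x of (S, i) \<Rightarrow> {u \<in> S. f S u = i}).
          case x of (S, i) \<Rightarrow> w S)"
        by (rule sum.reindex_bij_witness[of _ fst "\<lambda>S. (S, f S v)"]) (auto simp: f)
      finally show "1 \<le> \<dots>" .
    qed (use finJ in auto)
    also have "\<dots> = real d * (\<Sum>S | independent_set H S. w S)"
      by (simp add: sum.cartesian_product[symmetric] sum_distrib_left)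
    finally show "fractional_chromatic_number G / real d \<le> (\<Sum>S | independent_set H S. w S)"
      using \<open>0 < d\<close> by (simp add: divide_le_eq mult.commute)
  qed
  then show ?thesis using \<open>0 < d\<close> by (simp add: divide_le_eq mult.commute)
qed

text \<open>Colourings of the two parts are put side by side, indexed by a disjoint sum because a
  set such as {} is independent in both parts.\<close>

lemma fractional_chromatic_number_le_add:
  assumes G: "simple_graph G"
  shows "fractional_chromatic_number G \<le> fractional_chromatic_number (induced_subgraph G W)
    + fractional_chromatic_number (induced_subgraph G (verts G - W))"
proof -
  let ?A = "induced_subgraph G W" and ?B = "induced_subgraph G (verts G - W)"
  let ?I = "\<lambda>H. {S. independent_set H S}"
  have A: "simple_graph ?A" and B: "simple_graph ?B" using simple_graph_induced[OF G] by auto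
  have fin: "finite (?I H)" if "simple_graph H" for H :: "'a graph"
    using finite_independent_sets[OF that, of "\<lambda>_. True"] by simp
  have sum2: "fractional_chromatic_number G \<le> (\<Sum>S | independent_set ?A S. w S) + (\<Sum>S | independent_set ?B S. z S)"
    if w: "fractional_colouring ?A w" and z: "fractional_colouring ?B z" for w z
  proof -
    have "fractional_chromatic_number G \<le> sum (case_sum w z) (?I ?A <+> ?I ?B)"
    proof (rule fractional_chromatic_number_le[OF G, where T = "case_sum id id"])
      fix v assume v: "v \<in> verts G"
      have eq: "{x. x \<in> ?I ?A <+> ?I ?B \<and> v \<in> case_sum id id x}
          = {S \<in> ?I ?A. v \<in> S} <+> {S \<in> ?I ?B. v \<in> S}"
        by auto
      have "(\<Sum>x | x \<in> ?I ?A <+> ?I ?B \<and> v \<in> case_sum id id x. case_sum w z x)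
          = (\<Sum>S | independent_set ?A S \<and> v \<in> S. w S) + (\<Sum>S | independent_set ?B S \<and> v \<in> S. z S)"
        unfolding eq using fin[OF A] fin[OF B] by (subst sum.Plus) auto
      moreover have "1 \<le> (\<Sum>S | independent_set ?A S \<and> v \<in> S. w S)" if "v \<in> W"
        using w v that by (auto simp: fractional_colouring_def induced_subgraph_def)
      moreover have "1 \<le> (\<Sum>S | independent_set ?B S \<and> v \<in> S. z S)" if "v \<notin> W"
        using z v that by (auto simp: fractional_colouring_def induced_subgraph_def)
      moreover have "0 \<le> (\<Sum>S | independent_set ?A S \<and> v \<in> S. w S)"
        "0 \<le> (\<Sum>S | independent_set ?B S \<and> v \<in> S. z S)"
        using w z by (auto simp: fractional_colouring_def intro!: sum_nonneg)
      ultimately show "1 \<le> (\<Sum>x | x \<in> ?I ?A <+> ?I ?B \<and> v \<in> case_sum id id x. case_sum w z x)"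
        by (cases "v \<in> W") auto
    qed (use fin[OF A] fin[OF B] w z in \<open>auto simp: independent_set_induced fractional_colouring_def\<close>)
    then show ?thesis using fin[OF A] fin[OF B] by (simp add: sum.Plus)
  qed
  \<comment> \<open>No minimiser is chosen: the infimum is taken over \<open>z\<close> for fixed
    \<open>w\<close>, and then over \<open>w\<close>.\<close>
  have "fractional_chromatic_number G - (\<Sum>S | independent_set ?A S. w S) \<le> fractional_chromatic_number ?B"
    if "fractional_colouring ?A w" for w
    using sum2[OF that] by (intro le_fractional_chromatic_number[OF B]) (simp add: algebra_simps)
  then have "fractional_chromatic_number G - fractional_chromatic_number ?B \<le> fractional_chromatic_number ?A"
    by (intro le_fractional_chromatic_number[OF A]) (simp add: algebra_simps)
  then show ?thesis by simp
qed

section \<open>Degeneracy and edge counting\<close>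

text \<open>Greedy colouring: remove a vertex with fewer than \<open>d\<close> neighbours, colour
  the rest by induction, and give the vertex a colour below \<open>d\<close> that none of its
  neighbours has.\<close>

lemma degenerate_colouring:
  assumes "finite S"
    and deg: "\<And>T. T \<subseteq> S \<Longrightarrow> T \<noteq> {} \<Longrightarrow> \<exists>v\<in>T. card {u \<in> T. {u, v} \<in> E} < d"
  shows "\<exists>f. \<forall>v\<in>S. f v < d \<and> (\<forall>u\<in>S. u \<noteq> v \<longrightarrow> {u, v} \<in> E \<longrightarrow> f u \<noteq> f v)"
  using assms
proof (induction "card S" arbitrary: S)
  case 0
  then show ?case by auto
next
  case (Suc n)
  then have "S \<noteq> {}" by auto
  then obtain v where v: "v \<in> S" "card {u \<in> S. {u, v} \<in> E} < d"
    using Suc.prems(2)[of S] by auto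
  have "\<exists>f. \<forall>x\<in>S - {v}. f x < d \<and> (\<forall>u\<in>S - {v}. u \<noteq> x \<longrightarrow> {u, x} \<in> E \<longrightarrow> f u \<noteq> f x)"
    by (rule Suc.hyps(1)) (use Suc.hyps(2) Suc.prems v in auto)
  then obtain f where f: "\<And>x. x \<in> S - {v} \<Longrightarrow> f x < d"
    "\<And>x u. x \<in> S - {v} \<Longrightarrow> u \<in> S - {v} \<Longrightarrow> u \<noteq> x \<Longrightarrow> {u, x} \<in> E \<Longrightarrow> f u \<noteq> f x"
    by blast
  have "card (f ` {u \<in> S. {u, v} \<in> E}) < card {..<d}"
    using card_image_le[of "{u \<in> S. {u, v} \<in> E}" f] v Suc.prems(1) by simp
  then have "\<not> {..<d} \<subseteq> f ` {u \<in> S. {u, v} \<in> E}"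
    using Suc.prems(1) card_mono[of "f ` {u \<in> S. {u, v} \<in> E}" "{..<d}"] by fastforce
  then obtain c where c: "c < d" "\<And>u. u \<in> S \<Longrightarrow> {u, v} \<in> E \<Longrightarrow> f u \<noteq> c" by blast
  show ?case
  proof (intro exI[of _ "f(v := c)"] ballI conjI impI)
    fix x u assume "x \<in> S" "u \<in> S" "u \<noteq> x" "{u, x} \<in> E"
    then show "(f(v := c)) u \<noteq> (f(v := c)) x"
      using f(2)[of x u] c(2)[of u] c(2)[of x] by (auto simp: insert_commute)
  qed (use f c in auto)
qed

text \<open>Double counting of incident pairs of a vertex of \<open>T\<close> and an edge inside
  \<open>T\<close>: every edge is counted twice, every vertex at least \<open>d\<close>
  times.\<close>

lemma card_edges_ge_of_min_degree:
  assumes G: "simple_graph G" and T: "T \<subseteq> verts G"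
    and deg: "\<And>v. v \<in> T \<Longrightarrow> d \<le> card {u \<in> T. {u, v} \<in> edges G}"
  shows "d * card T \<le> 2 * card {e \<in> edges G. e \<subseteq> T}"
proof -
  let ?Q = "{e \<in> edges G. e \<subseteq> T}"
  have fin: "finite T" "finite ?Q"
    using G T finite_edges[OF G] finite_subset by (auto simp: simple_graph_def)
  have "card {u \<in> T. {u, v} \<in> edges G} \<le> card {e \<in> ?Q. v \<in> e}" if "v \<in> T" for v
    by (rule card_inj_on_le[of "\<lambda>u. {u, v}"])
       (use that fin in \<open>auto simp: inj_on_def doubleton_eq_iff\<close>)
  then have "(\<Sum>v\<in>T. d) \<le> (\<Sum>v\<in>T. card {e \<in> ?Q. v \<in> e})"
    using deg by (intro sum_mono) (meson le_trans)
  also have "\<dots> = (\<Sum>e\<in>?Q. card {v \<in> T. v \<in> e})"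
    using sum.swap_restrict[OF fin, of "\<lambda>_ _. 1 :: nat" "\<lambda>v e. v \<in> e"] by simp
  also have "\<dots> = (\<Sum>e\<in>?Q. 2)"
  proof (rule sum.cong)
    fix e assume "e \<in> ?Q"
    then have "{v \<in> T. v \<in> e} = e" "card e = 2" using G by (auto simp: simple_graph_def)
    then show "card {v \<in> T. v \<in> e} = 2" by simp
  qed simp
  finally show ?thesis by (simp add: mult.commute)
qed

section \<open>Counting short cycles through an edge\<close>

text \<open>Equal edges at distinct positions \<open>i\<close> and \<open>j\<close> would make each
  position the cyclic successor of the other, which is impossible for length at least 3. So the
  length of a cycle can be read off its edge set.\<close>

lemma card_edges_cycle_graph:
  assumes "cycle_graph C"
  shows "card (edges C) = card (verts C)" and "3 \<le> card (verts C)"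
proof -
  obtain vs where vs: "3 \<le> length vs" "distinct vs" "verts C = set vs"
      and "edges C = {{vs ! i, vs ! (Suc i mod length vs)} | i. i < length vs}"
    using assms unfolding cycle_graph_def by blast
  then have edges: "edges C = (\<lambda>i. {vs ! i, vs ! (Suc i mod length vs)}) ` {..<length vs}"
    by auto
  have nth: "vs ! i = vs ! j \<longleftrightarrow> i = j" if "i < length vs" "j < length vs" for i j
    using vs that by (simp add: nth_eq_iff_index_eq)
  have "inj_on (\<lambda>i. {vs ! i, vs ! (Suc i mod length vs)}) {..<length vs}"
  proof (rule inj_onI)
    fix i j assume ij: "i \<in> {..<length vs}" "j \<in> {..<length vs}"
      and eq: "{vs ! i, vs ! (Suc i mod length vs)} = {vs ! j, vs ! (Suc j mod length vs)}"
    have lt: "Suc i mod length vs < length vs" "Suc j mod length vs < length vs"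
      using vs(1) by (auto intro!: mod_less_divisor)
    show "i = j"
    proof (rule ccontr)
      assume "i \<noteq> j"
      then have m: "i = Suc j mod length vs" "Suc i mod length vs = j"
        using eq nth[of i j] nth[of i "Suc j mod length vs"] nth[of "Suc i mod length vs" j] lt ij
        unfolding doubleton_eq_iff lessThan_iff by blast+
      have "i = 0 \<and> Suc j = length vs \<or> i = Suc j"
        using m(1) ij(2) by (cases "Suc j = length vs") simp_all
      moreover have "j = 0 \<and> Suc i = length vs \<or> j = Suc i"
        using m(2) ij(1) by (cases "Suc i = length vs") simp_all
      ultimately show False using vs(1) by linarith
    qed
  qed
  then have "card (edges C) = length vs"
    unfolding edges by (simp only: card_image card_lessThan)
  with vs show "card (edges C) = card (verts C)" "3 \<le> card (verts C)"
    by (simp_all only: distinct_card)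
qed

text \<open>Cycles are recorded by their edges because the random object is a set of edges and the
  deleted cycles are to be edge-disjoint.\<close>

definition short_cycle_edge_sets :: "nat \<Rightarrow> 'v graph \<Rightarrow> 'v set set set" where
  "short_cycle_edge_sets r G = {edges C | C. cycle_graph C \<and> subgraph C G \<and> card (verts C) < r}"

lemma short_cycle_edge_setsD:
  assumes "C \<in> short_cycle_edge_sets r G"
  shows "C \<subseteq> edges G" "3 \<le> card C" "card C < r"
proof -
  obtain D where "C = edges D" "cycle_graph D" "subgraph D G" "card (verts D) < r"
    using assms unfolding short_cycle_edge_sets_def by blast
  then show "C \<subseteq> edges G" "3 \<le> card C" "card C < r"
    using card_edges_cycle_graph[of D] unfolding subgraph_def by simp_all
qed

lemma finite_short_cycle_edge_sets: "simple_graph G \<Longrightarrow> finite (short_cycle_edge_sets r G)"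
  by (rule finite_subset[of _ "Pow (edges G)"])
     (auto simp: finite_edges dest: short_cycle_edge_setsD(1))

lemma finite_clique_cover:
  assumes "simple_graph G" "short_cycle_clique_cover r G \<K>"
  shows "finite \<K>"
  using assms(2) by (intro finite_subset[OF _ finite_subgraphs[OF assms(1)]])
    (auto simp: short_cycle_clique_cover_def clique_in_def)

text \<open>
  A short cycle through an edge \<open>e\<close> lies in one of the few cliques containing \<open>e\<close>; inside such a
  clique it is determined, up to a bounded choice of its edges, by its vertices outside \<open>e\<close>.
\<close>

lemma card_short_cycles_through_edge_le:
  assumes G: "simple_graph G" and cover: "short_cycle_clique_cover r G \<K>"
    and size: "\<And>K. K \<in> \<K> \<Longrightarrow> card (verts K) \<le> N" and e: "e \<in> edges G" and "2 \<le> k"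
  shows "card {C \<in> short_cycle_edge_sets r G. e \<in> C \<and> card C = k}
    \<le> local_overlap G \<K> * (N ^ (k - 2) * 2 ^ 2 ^ k)"
proof -
  obtain u v where uv: "e = {u, v}" "u \<noteq> v" "u \<in> verts G"
    using G e by (metis card_2_iff insert_subset simple_graph_def)
  \<comment> \<open>A clique containing the cycle contains the end \<open>u\<close> of
    \<open>e\<close>, so \<open>local_overlap\<close> bounds the number of candidates.\<close>
  define \<K>u where "\<K>u = {K \<in> \<K>. u \<in> verts K}"
  have fin\<K>: "finite \<K>u" using finite_clique_cover[OF G cover] by (simp add: \<K>u_def)
  have finK: "finite (verts K)" if "K \<in> \<K>" for K
    using that cover by (auto simp: short_cycle_clique_cover_def clique_in_def subgraph_def simple_graph_def)
  \<comment> \<open>A list names the \<open>k - 2\<close> vertices outside \<open>e\<close>. The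
    edge set is then some set of subsets of at most \<open>k\<close> vertices, which leaves at most
    \<open>2 ^ 2 ^ k\<close> choices.\<close>
  let ?L = "\<lambda>K. {xs. set xs \<subseteq> verts K \<and> length xs = k - 2}"
  let ?P = "\<lambda>xs. Pow (Pow ({u, v} \<union> set xs))"
  have "{C \<in> short_cycle_edge_sets r G. e \<in> C \<and> card C = k} \<subseteq> (\<Union>K\<in>\<K>u. \<Union>xs\<in>?L K. ?P xs)"
  proof
    fix D assume "D \<in> {C \<in> short_cycle_edge_sets r G. e \<in> C \<and> card C = k}"
    then obtain C where C: "D = edges C" "cycle_graph C" "subgraph C G" "card (verts C) < r"
      and D: "e \<in> edges C" "card (edges C) = k"
      by (auto simp: short_cycle_edge_sets_def)
    obtain K where K: "K \<in> \<K>" "subgraph C K"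
      using cover C by (auto simp: short_cycle_clique_cover_def)
    have sC: "finite (verts C)" "\<And>e. e \<in> edges C \<Longrightarrow> e \<subseteq> verts C" "verts C \<subseteq> verts K"
      using C K by (auto simp: subgraph_def simple_graph_def)
    have uvC: "{u, v} \<subseteq> verts C" using sC(2) D uv by blast
    obtain xs where xs: "set xs = verts C - {u, v}" "distinct xs"
      using finite_distinct_list sC(1) by (metis finite_Diff)
    have "length xs = k - 2"
      using distinct_card[OF xs(2)] xs(1) uvC uv(2) D(2) card_edges_cycle_graph(1)[OF C(2)]
      by (simp add: card_Diff_subset)
    then have "xs \<in> ?L K" using xs sC by auto
    moreover have "D \<in> ?P xs" using C(1) sC(2) xs(1) by auto
    moreover have "K \<in> \<K>u" using K uvC sC by (auto simp: \<K>u_def)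
    ultimately show "D \<in> (\<Union>K\<in>\<K>u. \<Union>xs\<in>?L K. ?P xs)" by blast
  qed
  moreover have finL: "finite (?L K)" if "K \<in> \<K>u" for K
    using finK that by (intro finite_lists_length_eq) (auto simp: \<K>u_def)
  ultimately have "card {C \<in> short_cycle_edge_sets r G. e \<in> C \<and> card C = k}
      \<le> card (\<Union>K\<in>\<K>u. \<Union>xs\<in>?L K. ?P xs)"
    using fin\<K> by (intro card_mono) auto
  also have "\<dots> \<le> (\<Sum>K\<in>\<K>u. card (\<Union>xs\<in>?L K. ?P xs))"
    by (rule card_UN_le[OF fin\<K>])
  also have "\<dots> \<le> (\<Sum>K\<in>\<K>u. N ^ (k - 2) * 2 ^ 2 ^ k)"
  proof (rule sum_mono)
    fix K assume K: "K \<in> \<K>u"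
    have "card (\<Union>xs\<in>?L K. ?P xs) \<le> (\<Sum>xs\<in>?L K. card (?P xs))"
      by (rule card_UN_le[OF finL[OF K]])
    also have "\<dots> \<le> (\<Sum>xs\<in>?L K. 2 ^ 2 ^ k)"
    proof (rule sum_mono)
      fix xs assume "xs \<in> ?L K"
      then have "card ({u, v} \<union> set xs) \<le> k"
        using card_Un_le[of "{u, v}" "set xs"] card_length[of xs] uv(2) \<open>2 \<le> k\<close> by auto
      then show "card (?P xs) \<le> 2 ^ 2 ^ k"
        by (simp add: card_Pow power_increasing)
    qed
    also have "\<dots> = card (verts K) ^ (k - 2) * 2 ^ 2 ^ k"
      using K finK by (simp add: card_lists_length_eq \<K>u_def)
    also have "\<dots> \<le> N ^ (k - 2) * 2 ^ 2 ^ k"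
      using K size by (intro mult_right_mono power_mono) (auto simp: \<K>u_def)
    finally show "card (\<Union>xs\<in>?L K. ?P xs) \<le> N ^ (k - 2) * 2 ^ 2 ^ k" .
  qed
  also have "\<dots> = card \<K>u * (N ^ (k - 2) * 2 ^ 2 ^ k)" by simp
  also have "\<dots> \<le> local_overlap G \<K> * (N ^ (k - 2) * 2 ^ 2 ^ k)"
  proof (rule mult_right_mono)
    show "card \<K>u \<le> local_overlap G \<K>"
      unfolding local_overlap_def \<K>u_def using G uv(3) by (intro Max_ge) (auto simp: simple_graph_def)
  qed simp
  finally show ?thesis .
qed

text \<open>Length \<open>k\<close> contributes a multiple of
  \<open>N ^ (k - 2) * p ^ k = (p * N) ^ (k - 2) * p\<^sup>2\<close>. Since
  \<open>1 \<le> p * N\<close>, the largest length \<open>r - 1\<close> dominates; the factor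
  \<open>r\<close> covers the number of lengths.\<close>

lemma sum_short_cycles_through_edge_le:
  fixes p :: real
  assumes G: "simple_graph G" and cover: "short_cycle_clique_cover r G \<K>"
    and size: "\<And>K. K \<in> \<K> \<Longrightarrow> card (verts K) \<le> N" and e: "e \<in> edges G"
    and "0 \<le> p" and "1 \<le> p * N"
  shows "(\<Sum>C | C \<in> short_cycle_edge_sets r G \<and> e \<in> C. p ^ card C)
    \<le> real r * real (local_overlap G \<K>) * 2 ^ 2 ^ r * (p * N) ^ (r - 3) * p\<^sup>2"
proof -
  let ?S = "{C. C \<in> short_cycle_edge_sets r G \<and> e \<in> C}"
  let ?B = "real (local_overlap G \<K>) * 2 ^ 2 ^ r * (p * N) ^ (r - 3) * p\<^sup>2"
  have "(\<Sum>C\<in>?S. p ^ card C) = (\<Sum>k\<in>{3..<r}. \<Sum>C\<in>{C \<in> ?S. card C = k}. p ^ card C)"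
    using finite_short_cycle_edge_sets[OF G] short_cycle_edge_setsD
    by (intro sum.group[symmetric]) auto
  also have "\<dots> = (\<Sum>k\<in>{3..<r}. card {C \<in> short_cycle_edge_sets r G. e \<in> C \<and> card C = k} * p ^ k)"
    by (intro sum.cong) auto
  also have "\<dots> \<le> (\<Sum>k\<in>{3..<r}. ?B)"
  proof (rule sum_mono)
    fix k assume k: "k \<in> {3..<r}"
    then have "k - 2 + 2 = k" using k by auto
    then have pk: "p ^ k = p ^ (k - 2) * p\<^sup>2" using power_add[of p "k - 2" 2] by simp
    have "real (card {C \<in> short_cycle_edge_sets r G. e \<in> C \<and> card C = k})
        \<le> real (local_overlap G \<K> * (N ^ (k - 2) * 2 ^ 2 ^ k))"
      using card_short_cycles_through_edge_le[OF G cover size e, of k] k by (subst of_nat_le_iff) auto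
    then have "card {C \<in> short_cycle_edge_sets r G. e \<in> C \<and> card C = k} * p ^ k
        \<le> real (local_overlap G \<K> * (N ^ (k - 2) * 2 ^ 2 ^ k)) * p ^ k"
      using assms by (intro mult_right_mono) auto
    also have "\<dots> = real (local_overlap G \<K>) * 2 ^ 2 ^ k * (p * N) ^ (k - 2) * p\<^sup>2"
      by (simp add: pk power_mult_distrib mult_ac)
    also have "\<dots> \<le> ?B"
      using k assms by (intro mult_right_mono mult_mono mult_left_mono power_increasing) auto
    finally show "card {C \<in> short_cycle_edge_sets r G. e \<in> C \<and> card C = k} * p ^ k \<le> ?B" .
  qed
  also have "\<dots> = (r - 3) * ?B" by simp
  also have "\<dots> \<le> r * ?B" using assms by (intro mult_right_mono) auto
  finally show ?thesis by (simp add: mult.assoc)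
qed

section \<open>Existence of a good subgraph of large girth\<close>

text \<open>\<open>exists_hitting_set_avoiding\<close> is applied to the edge sets
  \<open>Q T\<close> of all nonempty \<open>T\<close> in \<open>W\<close> of minimum degree at least
  \<open>d\<close>. The hypothesis \<open>few_cycles\<close> yields its condition on cycle weights,
  and \<open>many_edges\<close> makes the union bound over \<open>T\<close> succeed.\<close>

lemma exists_high_girth_subgraph:
  fixes p :: real and d :: nat
  assumes G: "simple_graph G" and cover: "short_cycle_clique_cover r G \<K>"
    and size: "\<And>K. K \<in> \<K> \<Longrightarrow> card (verts K) \<le> N"
    and p: "0 < p" "p \<le> 1 / 2" "1 \<le> p * N" and "0 < d"
    and few_cycles: "2 ^ r * (real r * real (local_overlap G \<K>) * 2 ^ 2 ^ r * (p * N) ^ (r - 3) * p) \<le> 1 / 2"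
    and W: "W \<subseteq> verts G" and many_edges: "card W * exp (- (p * d / 4)) \<le> 1 / 2"
  shows "\<exists>H. subgraph H G \<and> enat r \<le> girth H \<and>
    fractional_chromatic_number (induced_subgraph G W) \<le> d * fractional_chromatic_number H"
proof -
  define Q where "Q T = {e \<in> edges G. e \<subseteq> T}" for T
  define I where "I = {T. T \<subseteq> W \<and> T \<noteq> {} \<and> (\<forall>v\<in>T. d \<le> card {u \<in> T. {u, v} \<in> edges G})}"
  let ?\<C> = "short_cycle_edge_sets r G"
  have finV: "finite W" using G W by (auto simp: simple_graph_def intro: finite_subset)
  have finC: "finite ?\<C>" by (rule finite_short_cycle_edge_sets[OF G])
  have "2 ^ r * (\<Sum>C | C \<in> ?\<C> \<and> C \<inter> Q T \<noteq> {}. p ^ card C) \<le> p * card (Q T) / 2" for T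
  proof -
    have finQ: "finite (Q T)" using finite_edges[OF G] by (simp add: Q_def)
    \<comment> \<open>A cycle meeting \<open>Q T\<close> is charged to the edges it shares with
      \<open>Q T\<close>. Of the factor \<open>p\<^sup>2\<close> per edge, one \<open>p\<close> goes
      into \<open>few_cycles\<close> and the other matches \<open>p * card (Q T)\<close>.\<close>
    have "{C. C \<in> ?\<C> \<and> C \<inter> Q T \<noteq> {}} = (\<Union>e\<in>Q T. {C. C \<in> ?\<C> \<and> e \<in> C})" by auto
    then have "(\<Sum>C | C \<in> ?\<C> \<and> C \<inter> Q T \<noteq> {}. p ^ card C)
        \<le> (\<Sum>e\<in>Q T. \<Sum>C | C \<in> ?\<C> \<and> e \<in> C. p ^ card C)"
      using finQ finC p by (simp only:) (intro sum_UN_le, auto)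
    also have "\<dots> \<le> (\<Sum>e\<in>Q T. real r * real (local_overlap G \<K>) * 2 ^ 2 ^ r * (p * N) ^ (r - 3) * p\<^sup>2)"
      using p by (intro sum_mono sum_short_cycles_through_edge_le[OF G cover size]) (auto simp: Q_def)
    finally have "2 ^ r * (\<Sum>C | C \<in> ?\<C> \<and> C \<inter> Q T \<noteq> {}. p ^ card C)
        \<le> 2 ^ r * (\<Sum>e\<in>Q T. real r * real (local_overlap G \<K>) * 2 ^ 2 ^ r * (p * N) ^ (r - 3) * p\<^sup>2)"
      by (intro mult_left_mono) auto
    also have "\<dots> = 2 ^ r * (real r * real (local_overlap G \<K>) * 2 ^ 2 ^ r * (p * N) ^ (r - 3) * p) * (p * card (Q T))"
      by (simp add: power2_eq_square mult_ac)
    also have "\<dots> \<le> 1 / 2 * (p * card (Q T))"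
      using few_cycles p by (intro mult_right_mono) auto
    finally show ?thesis by simp
  qed
  moreover have "(\<Sum>T\<in>I. exp (- (p * card (Q T) / 2))) < 1"
  proof -
    let ?x = "exp (- (p * d / 4))"
    \<comment> \<open>Since \<open>Q T\<close> has at least \<open>d * card T / 2\<close> edges, the
      bound for \<open>T\<close> is a product over its vertices. Summing over all nonempty subsets
      of \<open>W\<close> then gives \<open>(1 + ?x) ^ card W - 1\<close>.\<close>
    have "(\<Sum>T\<in>I. exp (- (p * card (Q T) / 2))) \<le> (\<Sum>T\<in>I. ?x ^ card T)"
    proof (rule sum_mono)
      fix T assume T: "T \<in> I"
      have "d * card T \<le> 2 * card (Q T)"
        unfolding Q_def using T W by (intro card_edges_ge_of_min_degree[OF G]) (auto simp: I_def)
      then have "real (d * card T) \<le> real (2 * card (Q T))" by (subst of_nat_le_iff)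
      then have "p / 4 * (d * card T) \<le> p / 4 * (2 * card (Q T))"
        using p by (intro mult_left_mono) auto
      then have "- (p * card (Q T) / 2) \<le> card T * - (p * d / 4)"
        by (simp add: algebra_simps)
      then show "exp (- (p * card (Q T) / 2)) \<le> ?x ^ card T"
        unfolding exp_of_nat_mult[symmetric] by simp
    qed
    also have "\<dots> \<le> (\<Sum>T\<in>Pow W - {{}}. ?x ^ card T)"
      using finV by (intro sum_mono2) (auto simp: I_def)
    also have "\<dots> = (\<Sum>T\<in>Pow W. ?x ^ card T) - 1"
      using finV by (subst sum_diff1) auto
    also have "\<dots> = (1 + ?x) ^ card W - 1"
      using sum_Pow_prod_eq_prod_one_plus[OF finV, of "\<lambda>_. ?x"] by simp
    also have "\<dots> \<le> exp ?x ^ card W - 1"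
      by (intro diff_right_mono power_mono exp_ge_add_one_self) (simp add: add_nonneg_nonneg)
    also have "\<dots> = exp (card W * ?x) - 1" by (simp add: exp_of_nat_mult)
    also have "\<dots> \<le> exp (1 / 2) - 1" using many_edges by simp
    also have "\<dots> < 1"
    proof -
      have "exp (1 / 2 :: real) \<le> 1 + 1 / 2 + (1 / 2)\<^sup>2" by (rule exp_bound) auto
      then show ?thesis by (simp add: power2_eq_square)
    qed
    finally show ?thesis .
  qed
  moreover have "C \<subseteq> edges G \<and> C \<noteq> {} \<and> card C \<le> r" if "C \<in> ?\<C>" for C
    using short_cycle_edge_setsD[OF that] by auto
  moreover have "finite I" using finV by (simp add: I_def)
  ultimately obtain B where B: "B \<subseteq> edges G" "\<And>C. C \<in> ?\<C> \<Longrightarrow> \<not> C \<subseteq> B"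
      "\<And>T. T \<in> I \<Longrightarrow> B \<inter> Q T \<noteq> {}"
    using exists_hitting_set_avoiding[OF finite_edges[OF G], of p I ?\<C> r Q] p
    by (force simp: Q_def)
  \<comment> \<open>The vertex set is cut down to \<open>W\<close> to agree with
    \<open>induced_subgraph G W\<close>; edges of \<open>B\<close> inside members of
    \<open>I\<close> survive.\<close>
  define H where "H = induced_subgraph (Graph (verts G) B) W"
  have vH: "verts H = W" "edges H = {e \<in> B. e \<subseteq> W}"
    using W by (auto simp: H_def induced_subgraph_def)
  have H: "subgraph H G"
    using G B(1) W vH finV unfolding subgraph_def simple_graph_def by auto
  have indH: "independent_set H T \<Longrightarrow> T \<notin> I" for T
    using B(3)[of T] unfolding independent_set_def vH Q_def by blast
  have "enat r \<le> girth H"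
    unfolding girth_def
  proof (rule Inf_greatest, clarify)
    fix C assume C: "cycle_graph C" "subgraph C H"
    show "enat r \<le> enat (card (verts C))"
    proof (rule ccontr)
      assume "\<not> ?thesis"
      moreover have "subgraph C G" using C(2) H by (auto simp: subgraph_def)
      ultimately have "edges C \<in> ?\<C>" using C by (auto simp: short_cycle_edge_sets_def)
      moreover have "edges C \<subseteq> B" using C(2) vH by (auto simp: subgraph_def)
      ultimately show False using B(2) by blast
    qed
  qed
  moreover have "fractional_chromatic_number (induced_subgraph G W) \<le> d * fractional_chromatic_number H"
  proof (rule fractional_chromatic_number_le_mult)
    show "simple_graph (induced_subgraph G W)" by (rule simple_graph_induced[OF G])
    show "simple_graph H" using H by (simp add: subgraph_def)
    show "verts H = verts (induced_subgraph G W)" using vH W by (auto simp: induced_subgraph_def)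
    fix S assume S: "independent_set H S"
    have SW: "S \<subseteq> W" using S vH by (auto simp: independent_set_def)
    have "\<exists>f. \<forall>v\<in>S. f v < d \<and> (\<forall>u\<in>S. u \<noteq> v \<longrightarrow> {u, v} \<in> edges G \<longrightarrow> f u \<noteq> f v)"
    proof (rule degenerate_colouring)
      show "finite S" using SW finV finite_subset by blast
      fix T assume "T \<subseteq> S" "T \<noteq> {}"
      \<comment> \<open>Subsets of \<open>S\<close> stay independent in \<open>H\<close>, hence are
        not in \<open>I\<close>: each nonempty one has a vertex of degree below \<open>d\<close> in
        \<open>G\<close>.\<close>
      then have "T \<notin> I" "T \<subseteq> W" "T \<noteq> {}"
        using indH[OF independent_set_mono[OF S]] SW by blast+
      then show "\<exists>v\<in>T. card {u \<in> T. {u, v} \<in> edges G} < d"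
        unfolding I_def by (auto simp: not_le)
    qed
    then obtain f where f: "\<And>v. v \<in> S \<Longrightarrow> f v < d"
        "\<And>u v. v \<in> S \<Longrightarrow> u \<in> S \<Longrightarrow> u \<noteq> v \<Longrightarrow> {u, v} \<in> edges G \<Longrightarrow> f u \<noteq> f v"
      by blast
    have "independent_set (induced_subgraph G W) {u \<in> S. f u = i}" for i
      unfolding independent_set_induced unfolding independent_set_def
    proof (intro conjI ballI notI)
      fix e assume e: "e \<in> edges G" "e \<subseteq> {u \<in> S. f u = i}"
      then obtain u v where "e = {u, v}" "u \<noteq> v"
        using G by (metis card_2_iff simple_graph_def)
      then show False using e f(2)[of v u] by auto
    qed (use SW W in auto)
    then show "\<exists>f. \<forall>v\<in>S. f v < d \<and> independent_set (induced_subgraph G W) {u \<in> S. f u = f v}"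
      using f(1) by blast
  qed (rule \<open>0 < d\<close>)
  ultimately show ?thesis using H by blast
qed

section \<open>Choice of parameters and asymptotics\<close>

lemma fractional_chromatic_number_le_high_girth:
  assumes G: "simple_graph G" and H: "subgraph H G" "enat r \<le> girth H"
  shows "fractional_chromatic_number H \<le> high_girth_frac_chi r G"
  unfolding high_girth_frac_chi_def
proof (rule Max_ge)
  have "finite {H. subgraph H G \<and> enat r \<le> girth H}"
    using finite_subgraphs[OF G] by (rule rev_finite_subset) auto
  then show "finite {fractional_chromatic_number H | H. subgraph H G \<and> enat r \<le> girth H}"
    by simp
qed (use H in auto)

lemma powr_minus_one_mult_self: "0 < x \<Longrightarrow> x powr (- 1 + e) * x = x powr e"
  for x :: real
  using powr_add[of x "- 1 + e" 1] by simp

text \<open>The bound for a single \<open>N\<close>. The constant 32 is the product of 2 for the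
  uncovered part, 8 from the bound on \<open>d\<close>, and 2 from
  \<open>ln N \<le> 2 * ln t\<close>.\<close>

lemma high_girth_frac_chi_ge:
  fixes a b \<delta> p t :: real
  assumes G: "simple_graph G" and cover: "short_cycle_clique_cover r G \<K>"
    and size: "\<And>K. K \<in> \<K> \<Longrightarrow> card (verts K) \<le> N"
    and overlap: "local_overlap G \<K> \<le> b" and inc: "vertex_incidence_number \<K> \<le> N powr a"
    and t: "t = fractional_chromatic_number G" "exp 1 \<le> t" "1 \<le> p * t / ln t"
    and unc: "fractional_chromatic_number (uncovered_subgraph G \<K>) \<le> t / 2"
    and "3 \<le> N" "0 < a" "0 < \<delta>" "\<delta> \<le> 1 / 2" and p: "p = N powr (- 1 + \<delta>)" "p \<le> 1 / 2"
    and few_cycles: "2 ^ r * (real r * b * 2 ^ 2 ^ r * (p * N) ^ (r - 3) * p) \<le> 1 / 2"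
  shows "1 / (32 * (a + 1)) * (p * t / ln t) \<le> high_girth_frac_chi r G"
proof -
  define W where "W = (\<Union>K\<in>\<K>. verts K)"
  \<comment> \<open>With this \<open>d\<close>, \<open>exp (- (p * d / 4))\<close> is at most
    \<open>N powr (- (a + 1))\<close>. As \<open>card W\<close> is at most \<open>N powr a\<close>,
    the product is at most \<open>1 / N\<close>.\<close>
  define d where "d = nat \<lceil>4 * (a + 1) * ln N / p\<rceil>"
  have p0: "0 < p" using p assms by simp
  have "1 \<le> N powr \<delta>" using assms by (intro ge_one_powr_ge_zero) auto
  then have pN: "1 \<le> p * N"
    unfolding p using assms by (subst powr_minus_one_mult_self) auto
  have "exp 1 \<le> real N" using exp_le assms by linarith
  then have lnN: "1 \<le> ln N" using assms by (simp add: ln_ge_iff)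
  have t0: "0 < t" using t(2) exp_gt_zero[of "1 :: real"] by linarith
  then have lnt: "1 \<le> ln t" using t(2) by (simp add: ln_ge_iff)
  have le_d: "4 * (a + 1) * ln N / p \<le> d" unfolding d_def by linarith
  have big: "1 \<le> 4 * (a + 1) * ln N / p"
  proof -
    have "1 * 1 \<le> 4 * (a + 1) * ln N" using lnN assms by (intro mult_mono) auto
    then show ?thesis using p0 p(2) by (simp add: le_divide_eq)
  qed
  have d0: "0 < d" using le_d big by linarith
  \<comment> \<open>Rounding up a real number that is at least 1 at most doubles it.\<close>
  have d_le: "d \<le> 8 * (a + 1) * ln N / p" unfolding d_def using big by linarith
  have WV: "W \<subseteq> verts G"
    using cover unfolding W_def short_cycle_clique_cover_def clique_in_def subgraph_def by blast
  have "card W \<le> vertex_incidence_number \<K>"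
    unfolding W_def vertex_incidence_number_def by (rule card_UN_le[OF finite_clique_cover[OF G cover]])
  then have cW: "card W \<le> N powr a" using inc by linarith
  have "card W * exp (- (p * d / 4)) \<le> N powr a * N powr (- (a + 1))"
  proof (rule mult_mono[OF cW])
    have "(a + 1) * ln N \<le> p * d / 4" using le_d p0 by (simp add: field_simps)
    then have "- (p * d / 4) \<le> - (a + 1) * ln N" by linarith
    then show "exp (- (p * d / 4)) \<le> N powr (- (a + 1))"
      using \<open>3 \<le> N\<close> by (simp only: powr_def of_nat_eq_0_iff exp_le_cancel_iff) simp
  qed auto
  also have "\<dots> = N powr (- 1)" by (simp flip: powr_add)
  also have "\<dots> \<le> 1 / 2" using assms by (simp add: powr_minus field_simps)
  finally have edges: "card W * exp (- (p * d / 4)) \<le> 1 / 2" .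
  have "2 ^ r * (real r * real (local_overlap G \<K>) * 2 ^ 2 ^ r * (p * N) ^ (r - 3) * p)
      \<le> 2 ^ r * (real r * b * 2 ^ 2 ^ r * (p * N) ^ (r - 3) * p)"
    using overlap p0 by (intro mult_left_mono mult_right_mono) auto
  then have "2 ^ r * (real r * real (local_overlap G \<K>) * 2 ^ 2 ^ r * (p * N) ^ (r - 3) * p) \<le> 1 / 2"
    using few_cycles by linarith
  then obtain H where H: "subgraph H G" "enat r \<le> girth H"
    and le_H: "fractional_chromatic_number (induced_subgraph G W) \<le> d * fractional_chromatic_number H"
    using exists_high_girth_subgraph[OF G cover size p0 p(2) pN d0 _ WV edges] by blast
  let ?h = "high_girth_frac_chi r G"
  have hH: "fractional_chromatic_number H \<le> ?h"
    by (rule fractional_chromatic_number_le_high_girth[OF G H])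
  have "t / 2 \<le> fractional_chromatic_number (induced_subgraph G W)"
    using fractional_chromatic_number_le_add[OF G, of W] unc t(1)
    unfolding uncovered_subgraph_def W_def by simp
  also have "\<dots> \<le> d * ?h" using le_H mult_left_mono[OF hH, of d] by linarith
  finally have td: "t / 2 \<le> d * ?h" .
  then have "0 < d * ?h" using t0 by linarith
  then have h0: "0 < ?h" using d0 by (simp add: zero_less_mult_iff)
  \<comment> \<open>The ratio hypothesis and \<open>1 \<le> ln t\<close> give
    \<open>1 \<le> p * t\<close>, so \<open>t\<close> is at least
    \<open>N powr (1 - \<delta>)\<close>, and \<open>\<delta> \<le> 1 / 2\<close>.\<close>
  have "ln N \<le> 2 * ln t"
  proof -
    have "1 \<le> p * t" using t(3) lnt by (simp add: le_divide_eq)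
    then have "0 \<le> ln (p * t)" by simp
    also have "\<dots> = (- 1 + \<delta>) * ln N + ln t"
      using p0 t0 assms by (simp add: ln_mult ln_powr)
    finally have "(1 - \<delta>) * ln N \<le> ln t" by (simp add: algebra_simps)
    moreover have "1 / 2 * ln N \<le> (1 - \<delta>) * ln N"
      using lnN assms by (intro mult_right_mono) auto
    ultimately show ?thesis by simp
  qed
  then have "8 * (a + 1) * ln N / p \<le> 8 * (a + 1) * (2 * ln t) / p"
    using p0 assms by (intro divide_right_mono mult_left_mono) auto
  then have "d * ?h \<le> 8 * (a + 1) * (2 * ln t) / p * ?h"
    using d_le h0 by (intro mult_right_mono) auto
  then have "t / 2 \<le> 8 * (a + 1) * (2 * ln t) / p * ?h" using td by linarith
  then have "p * t \<le> ?h * (32 * (a + 1) * ln t)" using p0 by (simp add: field_simps)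
  moreover have "0 < 32 * (a + 1) * ln t" using lnt \<open>0 < a\<close> by simp
  ultimately have "p * t / (32 * (a + 1) * ln t) \<le> ?h" by (simp only: pos_divide_le_eq)
  then show ?thesis by simp
qed

theorem corollary9p18:
  fixes r :: nat and a b \<delta> :: real
  assumes "4 \<le> r" and "0 < a" and "1 \<le> b" and "0 < \<delta>" and "\<delta> < 1 / (real r - 1)"
  shows "\<exists>c>0. \<forall>(G :: nat \<Rightarrow> 'v graph) (\<K> :: nat \<Rightarrow> 'v graph set) (t :: nat \<Rightarrow> real) (p :: nat \<Rightarrow> real).
    (\<forall>N. simple_graph (G N)) \<longrightarrow>
    (\<forall>N. t N = fractional_chromatic_number (G N)) \<longrightarrow>
    (\<forall>N. p N = real N powr (- 1 + \<delta>)) \<longrightarrow>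
    filterlim t at_top sequentially \<longrightarrow>
    (\<forall>N. short_cycle_clique_cover r (G N) (\<K> N)) \<longrightarrow>
    (\<forall>\<^sub>F N in sequentially.
        real (local_overlap (G N) (\<K> N)) \<le> b \<and>
        real (vertex_incidence_number (\<K> N)) \<le> real N powr a \<and>
        (\<forall>K\<in>\<K> N. card (verts K) \<le> N)) \<longrightarrow>
    (\<lambda>N. fractional_chromatic_number (uncovered_subgraph (G N) (\<K> N))) \<in> o(t) \<longrightarrow>
    filterlim (\<lambda>N. p N * t N / ln (t N)) at_top sequentially \<longrightarrow>
      filterlim (\<lambda>N. high_girth_frac_chi r (G N)) at_top sequentially \<and>
      (\<forall>\<^sub>F N in sequentially. c * (p N * t N / ln (t N)) \<le> high_girth_frac_chi r (G N))"
\<comment> \<open>The constant is that of \<open>high_girth_frac_chi_ge\<close>; \<open>r\<close>,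
  \<open>b\<close> and \<open>\<delta>\<close> affect how large \<open>N\<close> must be, not the
  constant.\<close>
proof (intro exI[of _ "1 / (32 * (a + 1))"] conjI allI impI)
  show c0: "0 < 1 / (32 * (a + 1))" using assms by simp
  fix G :: "nat \<Rightarrow> 'v graph" and \<K> :: "nat \<Rightarrow> 'v graph set" and t p :: "nat \<Rightarrow> real"
  assume G: "\<forall>N. simple_graph (G N)" and t: "\<forall>N. t N = fractional_chromatic_number (G N)"
    and p: "\<forall>N. p N = real N powr (- 1 + \<delta>)" and t_top: "filterlim t at_top sequentially"
    and cover: "\<forall>N. short_cycle_clique_cover r (G N) (\<K> N)"
    and bounds: "\<forall>\<^sub>F N in sequentially.
        real (local_overlap (G N) (\<K> N)) \<le> b \<and>
        real (vertex_incidence_number (\<K> N)) \<le> real N powr a \<and>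
        (\<forall>K\<in>\<K> N. card (verts K) \<le> N)"
    and unc: "(\<lambda>N. fractional_chromatic_number (uncovered_subgraph (G N) (\<K> N))) \<in> o(t)"
    and ratio: "filterlim (\<lambda>N. p N * t N / ln (t N)) at_top sequentially"
  have \<delta>: "\<delta> * (real r - 1) < 1" using assms by (simp add: less_divide_eq)
  have "\<delta> * 2 \<le> \<delta> * (real r - 1)" using assms by (intro mult_left_mono) auto
  with \<delta> have \<delta>2: "\<delta> \<le> 1 / 2" by simp
  have tendsto0: "(\<lambda>N. C * real N powr e) \<longlonglongrightarrow> 0" if "e < 0" for C e
    using tendsto_mult[OF tendsto_const tendsto_neg_powr[OF that filterlim_real_sequentially], of C] by simp
  \<comment> \<open>The powers of \<open>N\<close> combine to the exponent
    \<open>\<delta> * (r - 3) + \<delta> - 1\<close>, which is negative because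
    \<open>\<delta> * (r - 1) < 1\<close>. The cycle weight therefore tends to 0.\<close>
  have few: "2 ^ r * (real r * b * 2 ^ 2 ^ r * (p N * N) ^ (r - 3) * p N)
      = 2 ^ r * real r * b * 2 ^ 2 ^ r * N powr (\<delta> * (real r - 2) - 1)" if "3 \<le> N" for N
  proof -
    have "p N * N = N powr \<delta>"
      unfolding p[rule_format] using that by (intro powr_minus_one_mult_self) auto
    then have "(p N * N) ^ (r - 3) * p N = N powr (\<delta> * (real r - 3)) * N powr (- 1 + \<delta>)"
      using p that assms by (simp add: powr_powr flip: powr_realpow)
    also have "\<dots> = N powr (\<delta> * (real r - 2) - 1)"
      by (simp add: algebra_simps flip: powr_add)
    finally show ?thesis by (simp add: mult.assoc)
  qed
  have "\<delta> * (real r - 2) \<le> \<delta> * (real r - 1)" using assms by (intro mult_left_mono) auto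
  then have "\<delta> * (real r - 2) - 1 < 0" using \<delta> by linarith
  from order_tendstoD(2)[OF tendsto0[OF this], of "1 / 2" "2 ^ r * real r * b * 2 ^ 2 ^ r"]
  have few_ev: "\<forall>\<^sub>F N in sequentially.
      2 ^ r * real r * b * 2 ^ 2 ^ r * N powr (\<delta> * (real r - 2) - 1) < 1 / 2" by simp
  have p_ev: "\<forall>\<^sub>F N in sequentially. real N powr (- 1 + \<delta>) < 1 / 2"
    using order_tendstoD(2)[OF tendsto0[of "- 1 + \<delta>" 1], of "1 / 2"] \<delta>2 by simp
  \<comment> \<open>The little-o hypothesis is applied with the constant 1/2, leaving at least half
    of \<open>t N\<close> to the covered part.\<close>
  have unc_ev: "\<forall>\<^sub>F N in sequentially.
      norm (fractional_chromatic_number (uncovered_subgraph (G N) (\<K> N))) \<le> 1 / 2 * norm (t N)"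
    by (rule landau_o.smallD[OF unc]) simp
  have t_ev: "\<forall>\<^sub>F N in sequentially. exp 1 \<le> t N"
    using t_top by (simp add: filterlim_at_top)
  have ratio_ev: "\<forall>\<^sub>F N in sequentially. 1 \<le> p N * t N / ln (t N)"
    using ratio by (simp only: filterlim_at_top)
  show quant: "\<forall>\<^sub>F N in sequentially.
      1 / (32 * (a + 1)) * (p N * t N / ln (t N)) \<le> high_girth_frac_chi r (G N)"
    using bounds few_ev p_ev unc_ev t_ev ratio_ev eventually_ge_at_top[of 3]
  proof eventually_elim
    case (elim N)
    have "2 ^ r * (real r * b * 2 ^ 2 ^ r * (p N * N) ^ (r - 3) * p N) \<le> 1 / 2"
      using elim few[of N] by linarith
    moreover have "0 < t N" using elim exp_gt_zero[of "1 :: real"] by linarith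
    have "fractional_chromatic_number (uncovered_subgraph (G N) (\<K> N)) \<le> t N / 2"
      using elim(4) \<open>0 < t N\<close> by simp
    moreover have "p N \<le> 1 / 2" using elim(3) p by simp
    ultimately show ?case
      using elim G cover t p assms \<delta>2
      by (intro high_girth_frac_chi_ge[where \<K> = "\<K> N" and N = N and b = b and \<delta> = \<delta>]) blast+
  qed
  have "filterlim (\<lambda>N. 1 / (32 * (a + 1)) * (p N * t N / ln (t N))) at_top sequentially"
    by (rule filterlim_tendsto_pos_mult_at_top[OF tendsto_const c0 ratio])
  then show "filterlim (\<lambda>N. high_girth_frac_chi r (G N)) at_top sequentially"
    using quant by (rule filterlim_at_top_mono)
qed

end
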